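(* Let $G$ be a finite simple connected graph with at least three vertices and with size (number of edges) $m\ge 2$. Then $\chi'_L(G)=m$ if and only if $G\in\{P_4, C_3, C_4, K_{1,m}\}$.
   Context: $P_4$ is the path on four vertices, $C_n$ the cycle on $n$ vertices, and $K_{1,m}$ the star with $m$ edges. For a proper edge coloring $c:E(G)\to\{1,\dots,k\}$ of $G$, let $\pi=(\mathcal{C}_1,\dots,\mathcal{C}_k)$ be the ordered partition of $E(G)$ into color classes. For a vertex $v$ and an edge $e=xy$, $d(v,e)=\min\{d(v,x),d(v,y)\}$, and $d(v,\mathcal{C}_i)=\min\{d(v,e): e\in\mathcal{C}_i\}$. The edge color code of $v$ is $c_\pi(v)=(d(v,\mathcal{C}_1),\dots,d(v,\mathcal{C}_k))$. The coloring $c$ is an edge-locating coloring if distinct vertices have distinct edge color codes; $\chi'_L(G)$ is the minimum $k$ for which $G$ has an edge-locating coloring with $k$ colors. *)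

theory Defs
  imports Main
begin

type_synonym 'a graph = "'a set \<times> 'a set set"

abbreviation verts :: "'a graph \<Rightarrow> 'a set" where "verts \<equiv> fst"
abbreviation edges :: "'a graph \<Rightarrow> 'a set set" where "edges \<equiv> snd"

definition finite_simple_graph :: "'a graph \<Rightarrow> bool" where
  "finite_simple_graph G \<longleftrightarrow> finite (verts G) \<and> (\<forall>e\<in>edges G. e \<subseteq> verts G \<and> card e = 2)"

definition adj :: "'a graph \<Rightarrow> ('a \<times> 'a) set" where
  "adj G = {(x, y). {x, y} \<in> edges G}"

definition connected_graph :: "'a graph \<Rightarrow> bool" where
  "connected_graph G \<longleftrightarrow> verts G \<noteq> {} \<and> (\<forall>x\<in>verts G. \<forall>y\<in>verts G. (x, y) \<in> (adj G)\<^sup>*)"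

(* length of a shortest walk; only meaningful when x and y are joined by a walk *)
definition vdist :: "'a graph \<Rightarrow> 'a \<Rightarrow> 'a \<Rightarrow> nat" where
  "vdist G x y = (LEAST n. (x, y) \<in> adj G ^^ n)"

definition edge_dist :: "'a graph \<Rightarrow> 'a \<Rightarrow> 'a set \<Rightarrow> nat" where
  "edge_dist G v e = Min (vdist G v ` e)"

definition color_class :: "'a graph \<Rightarrow> ('a set \<Rightarrow> nat) \<Rightarrow> nat \<Rightarrow> 'a set set" where
  "color_class G c i = {e \<in> edges G. c e = i}"

definition class_dist :: "'a graph \<Rightarrow> 'a \<Rightarrow> 'a set set \<Rightarrow> nat" where
  "class_dist G v C = Min (edge_dist G v ` C)"

(* All k colors occur: the classes form a partition of the edge set, so none of them is
   empty and every minimum in a code is taken over a nonempty set. *)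
definition proper_edge_coloring :: "'a graph \<Rightarrow> nat \<Rightarrow> ('a set \<Rightarrow> nat) \<Rightarrow> bool" where
  "proper_edge_coloring G k c \<longleftrightarrow>
     c ` edges G = {1..k} \<and>
     (\<forall>e\<in>edges G. \<forall>f\<in>edges G. e \<noteq> f \<and> e \<inter> f \<noteq> {} \<longrightarrow> c e \<noteq> c f)"

definition edge_color_code :: "'a graph \<Rightarrow> nat \<Rightarrow> ('a set \<Rightarrow> nat) \<Rightarrow> 'a \<Rightarrow> nat list" where
  "edge_color_code G k c v = map (\<lambda>i. class_dist G v (color_class G c i)) [1..<Suc k]"

definition edge_locating_coloring :: "'a graph \<Rightarrow> nat \<Rightarrow> ('a set \<Rightarrow> nat) \<Rightarrow> bool" where
  "edge_locating_coloring G k c \<longleftrightarrow>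
     proper_edge_coloring G k c \<and> inj_on (edge_color_code G k c) (verts G)"

(* Only meaningful for graphs that have an edge-locating coloring; a connected graph with
   at least three vertices has one, obtained by giving all edges different colors. *)
definition edge_locating_number :: "'a graph \<Rightarrow> nat" where
  "edge_locating_number G = (LEAST k. \<exists>c. edge_locating_coloring G k c)"

definition graph_iso :: "'a graph \<Rightarrow> 'b graph \<Rightarrow> bool" where
  "graph_iso G H \<longleftrightarrow>
     (\<exists>f. bij_betw f (verts G) (verts H) \<and>
          (\<forall>x\<in>verts G. \<forall>y\<in>verts G. {x, y} \<in> edges G \<longleftrightarrow> {f x, f y} \<in> edges H))"

definition path_graph :: "nat \<Rightarrow> nat graph" where
  "path_graph n = ({..<n}, {{i, Suc i} | i. Suc i < n})"

(* a cycle only for n \<ge> 3 *)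
definition cycle_graph :: "nat \<Rightarrow> nat graph" where
  "cycle_graph n = ({..<n}, {{i, Suc i mod n} | i. i < n})"

(* center 0, leaves 1, ..., m *)
definition star_graph :: "nat \<Rightarrow> nat graph" where
  "star_graph m = ({0..m}, {{0, i} | i. i \<in> {1..m}})"

end

theory Submission
  imports Defs
begin

text \<open>
  Two vertices that lie on the same edges would form a component of their own, so a coloring
  with \<open>m\<close> different colors is locating. If two edges are disjoint, give them a common color and
  all other edges different ones. Two vertices with equal codes then lie one on each of the two
  edges, say \<open>e = xu\<close> and \<open>f = vy\<close>. Comparing which classes are at distance 0 and 1 from \<open>u\<close> and
  \<open>v\<close> leaves only \<open>uv\<close> and \<open>xy\<close> as possible further edges, so the graph is \<open>P\<^sub>4\<close> or \<open>C\<^sub>4\<close>. Without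
  two disjoint edges the graph is a star or a triangle, and a proper coloring repeats no color.
\<close>

section \<open>Minima in the naturals and explicit edge sets of the small graphs\<close>

text \<open>The whole argument only asks whether a distance is 0 or 1. For nested minima such
  questions reduce to membership, so no larger distance is ever computed.\<close>

lemma Min_eq_1_iff:
  fixes S :: "nat set"
  assumes "finite S" "S \<noteq> {}"
  shows "Min S = 1 \<longleftrightarrow> 0 \<notin> S \<and> 1 \<in> S"
proof
  assume "Min S = 1"
  then show "0 \<notin> S \<and> 1 \<in> S"
    using assms Min_in Min_le by (metis not_one_le_zero)
next
  assume "0 \<notin> S \<and> 1 \<in> S"
  then show "Min S = 1"
    using assms by (intro Min_eqI) (auto simp: Suc_le_eq intro: gr0I)
qed

lemma Min_eq_0_iff:
  fixes S :: "nat set"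
  assumes "finite S" "S \<noteq> {}"
  shows "Min S = 0 \<longleftrightarrow> 0 \<in> S"
  using assms Min_in Min_le by (metis le_zero_eq)

lemma edges_path4: "edges (path_graph 4) = {{0, 1}, {1, 2}, {2, 3}}"
proof -
  have "{i. Suc i < 4} = {0, 1, 2}" by auto
  moreover have "edges (path_graph 4) = (\<lambda>i. {i, Suc i}) ` {i. Suc i < 4}"
    by (auto simp: path_graph_def)
  ultimately show ?thesis by (simp add: numeral_eq_Suc)
qed

lemma edges_cycle3: "edges (cycle_graph 3) = {{0, 1}, {1, 2}, {2, 0}}"
proof -
  have "{i. i < 3} = {0, 1, 2::nat}" by auto
  moreover have "edges (cycle_graph 3) = (\<lambda>i. {i, Suc i mod 3}) ` {i. i < 3}"
    by (auto simp: cycle_graph_def)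
  ultimately show ?thesis by (simp add: numeral_2_eq_2)
qed

lemma edges_cycle4: "edges (cycle_graph 4) = {{0, 1}, {1, 2}, {2, 3}, {3, 0}}"
proof -
  have "{i. i < 4} = {0, 1, 2, 3::nat}" by auto
  moreover have "edges (cycle_graph 4) = (\<lambda>i. {i, Suc i mod 4}) ` {i. i < 4}"
    by (auto simp: cycle_graph_def)
  ultimately show ?thesis by (simp flip: numeral_2_eq_2)
qed

section \<open>Finite connected simple graphs\<close>

locale finite_connected_graph =
  fixes G :: "'a graph"
  assumes simple: "finite_simple_graph G"
    and connected: "connected_graph G"
begin

lemma finite_verts: "finite (verts G)"
  using simple by (simp add: finite_simple_graph_def)

lemma edge_subset: "e \<in> edges G \<Longrightarrow> e \<subseteq> verts G"
  using simple by (simp add: finite_simple_graph_def)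

lemma finite_edges: "finite (edges G)"
  using finite_verts edge_subset by (meson PowI finite_Pow_iff finite_subset subsetI)

lemma edge_other_end:
  assumes "e \<in> edges G" "x \<in> e"
  obtains y where "y \<noteq> x" "e = {x, y}"
proof -
  have "card e = 2" using assms simple by (simp add: finite_simple_graph_def)
  then obtain a b where "a \<noteq> b" "e = {a, b}" by (auto simp: card_2_iff)
  then show thesis using assms(2) that[of a] that[of b] by (auto simp: insert_commute)
qed

lemma edge_obtain:
  assumes "e \<in> edges G"
  obtains x y where "x \<noteq> y" "e = {x, y}"
  using assms simple by (auto simp: finite_simple_graph_def card_2_iff)

lemma no_loop [simp]: "{x} \<notin> edges G"
  using simple by (auto simp: finite_simple_graph_def)

text \<open>By induction along a walk from \<open>a\<close>, no step leaves \<open>A\<close>. This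
  is how connectedness turns a local description of neighbourhoods into the full vertex set.\<close>

lemma closed_eq_verts:
  assumes "A \<subseteq> verts G" "a \<in> A" and closed: "\<And>x y. x \<in> A \<Longrightarrow> {x, y} \<in> edges G \<Longrightarrow> y \<in> A"
  shows "A = verts G"
proof -
  have "b \<in> A" if "b \<in> verts G" for b
  proof -
    have "(a, b) \<in> (adj G)\<^sup>*"
      using connected that assms(1,2) by (auto simp: connected_graph_def)
    then show ?thesis
      by induction (use assms(2) closed in \<open>auto simp: adj_def\<close>)
  qed
  then show ?thesis using assms(1) by blast
qed

section \<open>Distances 0 and 1 to vertices, edges and color classes\<close>

text \<open>Connectedness supplies some walk, so the \<open>LEAST\<close> in \<open>vdist\<close> is
  attained.\<close>

lemma vdist_walk:
  assumes "x \<in> verts G" "y \<in> verts G"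
  shows "(x, y) \<in> adj G ^^ vdist G x y"
proof -
  obtain n where "(x, y) \<in> adj G ^^ n"
    using connected assms by (meson connected_graph_def rtrancl_imp_relpow)
  then show ?thesis unfolding vdist_def by (rule LeastI)
qed

lemma vdist_eq_0_iff:
  assumes "x \<in> verts G" "y \<in> verts G"
  shows "vdist G x y = 0 \<longleftrightarrow> x = y"
proof
  show "vdist G x y = 0 \<Longrightarrow> x = y" using vdist_walk[OF assms] by simp
  show "x = y \<Longrightarrow> vdist G x y = 0" by (simp add: vdist_def)
qed

lemma vdist_eq_1_iff:
  assumes "x \<in> verts G" "y \<in> verts G"
  shows "vdist G x y = 1 \<longleftrightarrow> {x, y} \<in> edges G"
proof
  show "vdist G x y = 1 \<Longrightarrow> {x, y} \<in> edges G"
    using vdist_walk[OF assms] by (simp add: adj_def)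
next
  assume xy: "{x, y} \<in> edges G"
  then have "vdist G x y \<le> 1"
    unfolding vdist_def by (intro Least_le) (simp add: adj_def)
  moreover have "vdist G x y \<noteq> 0" using xy vdist_eq_0_iff[OF assms] by auto
  ultimately show "vdist G x y = 1" by simp
qed

lemma edge_dist_eq_0_iff:
  assumes "v \<in> verts G" "e \<in> edges G"
  shows "edge_dist G v e = 0 \<longleftrightarrow> v \<in> e"
proof -
  obtain x y where e: "e = {x, y}" using assms edge_obtain by metis
  have "edge_dist G v e = 0 \<longleftrightarrow> 0 \<in> vdist G v ` e"
    unfolding edge_dist_def by (rule Min_eq_0_iff) (auto simp: e)
  moreover have "vdist G v w = 0 \<longleftrightarrow> v = w" if "w \<in> e" for w
    using vdist_eq_0_iff[of v w] that assms edge_subset by auto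
  ultimately show ?thesis by (auto simp: image_iff eq_commute[of 0])
qed

lemma edge_dist_eq_1_iff:
  assumes "v \<in> verts G" "e \<in> edges G"
  shows "edge_dist G v e = 1 \<longleftrightarrow> v \<notin> e \<and> (\<exists>w\<in>e. {v, w} \<in> edges G)"
proof -
  obtain x y where e: "e = {x, y}" using assms edge_obtain by metis
  have "edge_dist G v e = 1 \<longleftrightarrow> 0 \<notin> vdist G v ` e \<and> 1 \<in> vdist G v ` e"
    unfolding edge_dist_def by (rule Min_eq_1_iff) (auto simp: e)
  moreover have "vdist G v w = 0 \<longleftrightarrow> v = w" "vdist G v w = 1 \<longleftrightarrow> {v, w} \<in> edges G" if "w \<in> e" for w
    using vdist_eq_0_iff[of v w] vdist_eq_1_iff[of v w] that assms edge_subset by auto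
  ultimately show ?thesis by (auto simp: image_iff eq_commute[of 0] eq_commute[of "Suc 0"])
qed

lemma class_dist_eq_0_iff:
  assumes "v \<in> verts G" "C \<subseteq> edges G" "C \<noteq> {}"
  shows "class_dist G v C = 0 \<longleftrightarrow> v \<in> \<Union>C"
proof -
  have "class_dist G v C = 0 \<longleftrightarrow> 0 \<in> edge_dist G v ` C"
    unfolding class_dist_def
    by (rule Min_eq_0_iff) (use assms finite_edges finite_subset in auto)
  moreover have "edge_dist G v e = 0 \<longleftrightarrow> v \<in> e" if "e \<in> C" for e
    using edge_dist_eq_0_iff that assms by blast
  ultimately show ?thesis by (auto simp: image_iff eq_commute[of 0])
qed

lemma class_dist_eq_1_iff:
  assumes "v \<in> verts G" "C \<subseteq> edges G" "C \<noteq> {}"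
  shows "class_dist G v C = 1 \<longleftrightarrow> v \<notin> \<Union>C \<and> (\<exists>w\<in>\<Union>C. {v, w} \<in> edges G)"
proof -
  have "class_dist G v C = 1 \<longleftrightarrow> 0 \<notin> edge_dist G v ` C \<and> 1 \<in> edge_dist G v ` C"
    unfolding class_dist_def
    by (rule Min_eq_1_iff) (use assms finite_edges finite_subset in auto)
  moreover have "edge_dist G v e = 0 \<longleftrightarrow> v \<in> e"
    "edge_dist G v e = 1 \<longleftrightarrow> v \<notin> e \<and> (\<exists>w\<in>e. {v, w} \<in> edges G)" if "e \<in> C" for e
    using edge_dist_eq_0_iff edge_dist_eq_1_iff that assms by blast+
  ultimately show ?thesis by (auto simp: image_iff eq_commute[of 0] eq_commute[of "Suc 0"])
qed

text \<open>Since every color occurs, the entries of a code can be indexed by edges instead of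
  colors. A class named by one of its edges is nonempty, as the distance lemmas require.\<close>

lemma edge_color_code_eq_iff:
  assumes "c ` edges G = {1..k}"
  shows "edge_color_code G k c u = edge_color_code G k c v \<longleftrightarrow>
    (\<forall>e\<in>edges G. class_dist G u (color_class G c (c e)) = class_dist G v (color_class G c (c e)))"
proof -
  have "edge_color_code G k c u = edge_color_code G k c v \<longleftrightarrow>
    (\<forall>i\<in>{1..k}. class_dist G u (color_class G c i) = class_dist G v (color_class G c i))"
    by (auto simp: edge_color_code_def)
  also have "{1..k} = c ` edges G" using assms by simp
  finally show ?thesis by simp
qed

section \<open>Colorings with as many colors as edges\<close>

text \<open>If \<open>u\<close> and \<open>v\<close> were different, an edge at one of them would
  contain both and hence be \<open>{u, v}\<close>. This pair would then be closed under adjacency,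
  leaving only two vertices.\<close>

lemma same_edges_imp_eq:
  assumes "card (verts G) \<ge> 3" "u \<in> verts G" "v \<in> verts G"
    and same: "\<And>e. e \<in> edges G \<Longrightarrow> u \<in> e \<longleftrightarrow> v \<in> e"
  shows "u = v"
proof (rule ccontr)
  assume "u \<noteq> v"
  have "{u, v} = verts G"
  proof (rule closed_eq_verts[of _ u])
    fix x y assume "x \<in> {u, v}" "{x, y} \<in> edges G"
    then show "y \<in> {u, v}" using same[of "{x, y}"] \<open>u \<noteq> v\<close> by auto
  qed (use assms in auto)
  then have "card (verts G) = card {u, v}" by simp
  then show False using assms(1) card_insert_le_m1[of 2 "{v}" u] by simp
qed

text \<open>When all colors differ, every class is a single edge, so the zeros of a code list
  exactly the edges at the vertex.\<close>

lemma edge_locating_coloring_card: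
  assumes "card (verts G) \<ge> 3"
  shows "\<exists>c. edge_locating_coloring G (card (edges G)) c"
proof -
  let ?m = "card (edges G)"
  obtain c where c: "bij_betw c (edges G) {1..?m}"
    using finite_edges by (metis card_atLeastAtMost diff_Suc_1 finite_atLeastAtMost finite_same_card_bij)
  then have inj: "inj_on c (edges G)" and img: "c ` edges G = {1..?m}"
    by (auto simp: bij_betw_def)
  have cls: "color_class G c (c e) = {e}" if "e \<in> edges G" for e
    using that inj by (auto simp: color_class_def inj_on_def)
  have "inj_on (edge_color_code G ?m c) (verts G)"
  proof (rule inj_onI)
    fix u v assume uv: "u \<in> verts G" "v \<in> verts G"
      and code: "edge_color_code G ?m c u = edge_color_code G ?m c v"
    show "u = v"
    proof (rule same_edges_imp_eq[OF assms uv])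
      fix e assume e: "e \<in> edges G"
      then have "class_dist G u {e} = class_dist G v {e}"
        using code cls edge_color_code_eq_iff[OF img] by metis
      then show "u \<in> e \<longleftrightarrow> v \<in> e"
        using class_dist_eq_0_iff[of u "{e}"] class_dist_eq_0_iff[of v "{e}"] uv e by simp
    qed
  qed
  then have "edge_locating_coloring G ?m c"
    using inj img by (auto simp: edge_locating_coloring_def proper_edge_coloring_def inj_on_def)
  then show ?thesis by blast
qed

text \<open>The number of edges is always attained, so only minimality is in question. This removes
  \<open>LEAST\<close> from the later arguments.\<close>

lemma edge_locating_number_eq_card_iff:
  assumes "card (verts G) \<ge> 3"
  shows "edge_locating_number G = card (edges G) \<longleftrightarrow>
    (\<forall>k c. edge_locating_coloring G k c \<longrightarrow> card (edges G) \<le> k)"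
proof
  assume L: "edge_locating_number G = card (edges G)"
  have "edge_locating_number G \<le> k" if "edge_locating_coloring G k c" for k c
    unfolding edge_locating_number_def by (rule Least_le) (use that in blast)
  then show "\<forall>k c. edge_locating_coloring G k c \<longrightarrow> card (edges G) \<le> k"
    unfolding L by blast
next
  assume "\<forall>k c. edge_locating_coloring G k c \<longrightarrow> card (edges G) \<le> k"
  then show "edge_locating_number G = card (edges G)"
    unfolding edge_locating_number_def
    by (intro Least_equality edge_locating_coloring_card[OF assms]) blast
qed

section \<open>Merging the colors of two disjoint edges\<close>

text \<open>Naming the four vertices in order keeps isomorphisms out of the coloring arguments;
  \<open>graph_iso_path4_iff\<close> supplies the translation.\<close>

definition is_path4 :: "'a \<Rightarrow> 'a \<Rightarrow> 'a \<Rightarrow> 'a \<Rightarrow> bool" where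
  "is_path4 x u v y \<longleftrightarrow> distinct [x, u, v, y] \<and> verts G = {x, u, v, y} \<and>
     edges G = {{x, u}, {u, v}, {v, y}}"

definition is_cycle4 :: "'a \<Rightarrow> 'a \<Rightarrow> 'a \<Rightarrow> 'a \<Rightarrow> bool" where
  "is_cycle4 x u v y \<longleftrightarrow> distinct [x, u, v, y] \<and> verts G = {x, u, v, y} \<and>
     edges G = {{x, u}, {u, v}, {v, y}, {y, x}}"

text \<open>The hypothesis \<open>inj\<close> makes \<open>e\<close> and \<open>f\<close> the only
  pair of edges with a common color, so every other class is a singleton. Zero entries then control
  the edges at \<open>u\<close> and \<open>v\<close>, and entries 1 control those at the other ends
  \<open>x\<close> and \<open>y\<close>.\<close>

lemma merged_coloring_conflict:
  assumes e: "e \<in> edges G" and f: "f \<in> edges G" and disj: "e \<inter> f = {}" and cef: "c e = c f"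
    and inj: "\<And>g h. g \<in> edges G \<Longrightarrow> h \<in> edges G \<Longrightarrow> c g = c h \<Longrightarrow> g \<noteq> h \<Longrightarrow> {g, h} = {e, f}"
    and ue: "u \<in> e" and vf: "v \<in> f"
    and code: "\<And>g. g \<in> edges G \<Longrightarrow>
      class_dist G u (color_class G c (c g)) = class_dist G v (color_class G c (c g))"
  shows "\<exists>a b c d. is_path4 a b c d \<or> is_cycle4 a b c d"
proof -
  obtain x where x: "x \<noteq> u" "e = {u, x}" using edge_other_end[OF e ue] by blast
  obtain y where y: "y \<noteq> v" "f = {v, y}" using edge_other_end[OF f vf] by blast
  have dist: "distinct [x, u, v, y]" using x y disj by auto
  have V: "x \<in> verts G" "u \<in> verts G" "v \<in> verts G" "y \<in> verts G"
    using x y e f edge_subset by auto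
  have cls: "color_class G c (c g) = {g}" if "g \<in> edges G" "g \<noteq> e" "g \<noteq> f" for g
  proof -
    have "h = g" if "h \<in> edges G" "c h = c g" for h
      using inj[of h g] that \<open>g \<in> edges G\<close> \<open>g \<noteq> e\<close> \<open>g \<noteq> f\<close> by (metis doubleton_eq_iff)
    then show ?thesis using \<open>g \<in> edges G\<close> by (auto simp: color_class_def)
  qed
  have same: "u \<in> g \<longleftrightarrow> v \<in> g" if g: "g \<in> edges G" "g \<noteq> e" "g \<noteq> f" for g
    using code[OF g(1)] cls[OF g] V g
      class_dist_eq_0_iff[of u "{g}"] class_dist_eq_0_iff[of v "{g}"] by simp
  have same1: "(u \<notin> g \<and> (\<exists>w\<in>g. {u, w} \<in> edges G)) \<longleftrightarrow> (v \<notin> g \<and> (\<exists>w\<in>g. {v, w} \<in> edges G))"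
    if g: "g \<in> edges G" "g \<noteq> e" "g \<noteq> f" for g
    using code[OF g(1)] cls[OF g] V g
      class_dist_eq_1_iff[of u "{g}"] class_dist_eq_1_iff[of v "{g}"] by simp
  \<comment> \<open>An edge at \<open>u\<close> other than \<open>e\<close> has entry 0 for
    \<open>u\<close>, hence also for \<open>v\<close>, so it must be \<open>{u, v}\<close>.\<close>
  have Nu: "w = x \<or> w = v" if "{u, w} \<in> edges G" for w
  proof (rule ccontr)
    assume "\<not> (w = x \<or> w = v)"
    then show False using same[OF that] dist x y by (auto simp: doubleton_eq_iff)
  qed
  have Nv: "w = y \<or> w = u" if "{v, w} \<in> edges G" for w
  proof (rule ccontr)
    assume "\<not> (w = y \<or> w = u)"
    then show False using same[OF that] dist x y by (auto simp: doubleton_eq_iff)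
  qed
  \<comment> \<open>If \<open>w\<close> were another vertex, \<open>{x, w}\<close> would be at
    distance 1 from \<open>u\<close> through \<open>x\<close>, hence also from \<open>v\<close>. But
    \<open>v\<close> can only be adjacent to \<open>y\<close> and \<open>u\<close>, and neither lies
    on \<open>{x, w}\<close>.\<close>
  have Nx: "w = u \<or> w = y" if xw: "{x, w} \<in> edges G" for w
  proof (rule ccontr)
    assume w: "\<not> (w = u \<or> w = y)"
    have "{x, w} \<noteq> e" "{x, w} \<noteq> f" "u \<notin> {x, w}"
      using w dist x y by (auto simp: doubleton_eq_iff)
    moreover have "{u, x} \<in> edges G" using e x by simp
    ultimately have "\<exists>z\<in>{x, w}. {v, z} \<in> edges G" using same1[OF xw] by auto
    then show False using Nv w dist by auto
  qed
  have Ny: "w = v \<or> w = x" if yw: "{y, w} \<in> edges G" for w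
  proof (rule ccontr)
    assume w: "\<not> (w = v \<or> w = x)"
    have "{y, w} \<noteq> e" "{y, w} \<noteq> f" "v \<notin> {y, w}"
      using w dist x y by (auto simp: doubleton_eq_iff)
    moreover have "{v, y} \<in> edges G" using f y by simp
    ultimately have "\<exists>z\<in>{y, w}. {u, z} \<in> edges G" using same1[OF yw] by auto
    then show False using Nu w dist by auto
  qed
  have verts: "{x, u, v, y} = verts G"
    by (rule closed_eq_verts[of _ u]) (use V Nu Nv Nx Ny in auto)
  have sub: "edges G \<subseteq> {{x, u}, {u, v}, {v, y}, {y, x}}"
  proof
    fix g assume g: "g \<in> edges G"
    then obtain a b where ab: "g = {a, b}" using edge_obtain by metis
    then have "a \<in> {x, u, v, y}" using g edge_subset verts by blast
    then show "g \<in> {{x, u}, {u, v}, {v, y}, {y, x}}"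
      using g Nu[of b] Nv[of b] Nx[of b] Ny[of b] unfolding ab by auto
  qed
  have sup: "{x, u} \<in> edges G" "{v, y} \<in> edges G" using e f x y by (auto simp: insert_commute)
  \<comment> \<open>With both connecting edges absent, \<open>{x, u}\<close> would be a component
    missing \<open>v\<close>.\<close>
  have "{u, v} \<in> edges G \<or> {y, x} \<in> edges G"
  proof (rule ccontr)
    assume no: "\<not> ({u, v} \<in> edges G \<or> {y, x} \<in> edges G)"
    have "{x, u} = verts G"
    proof (rule closed_eq_verts[of _ u])
      fix a b assume "a \<in> {x, u}" "{a, b} \<in> edges G"
      then show "b \<in> {x, u}" using Nx[of b] Nu[of b] no by (auto simp: insert_commute)
    qed (use V in auto)
    then show False using dist V by auto
  qed
  then consider "{u, v} \<in> edges G" "{y, x} \<in> edges G"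
    | "{u, v} \<in> edges G" "{y, x} \<notin> edges G" | "{u, v} \<notin> edges G" "{y, x} \<in> edges G"
    by blast
  then show ?thesis
  proof cases
    case 1
    then have "is_cycle4 x u v y"
      unfolding is_cycle4_def using dist verts sub sup by blast
    then show ?thesis by blast
  next
    case 2
    then have "is_path4 x u v y"
      unfolding is_path4_def using dist verts sub sup by blast
    then show ?thesis by blast
  next
    case 3
    \<comment> \<open>Without \<open>{u, v}\<close> the path runs \<open>u\<close>,
      \<open>x\<close>, \<open>y\<close>, \<open>v\<close>; the two merged edges are again its end
      edges.\<close>
    then have "edges G = {{x, u}, {y, x}, {v, y}}" using sub sup by blast
    then have "is_path4 u x y v"
      unfolding is_path4_def using dist verts by (auto simp: insert_commute)
    then show ?thesis by blast
  qed
qed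

text \<open>Merging \<open>e\<close> and \<open>f\<close> saves one color. By the preceding lemma,
  vertices with equal codes do not lie one on \<open>e\<close> and the other on \<open>f\<close>.
  The zero of the merged class then puts both on \<open>e\<close>, both on \<open>f\<close>, or
  neither on either, so the two vertices lie on the same edges and coincide.\<close>

lemma disjoint_edges_imp_fewer_colors:
  assumes "card (verts G) \<ge> 3"
    and e: "e \<in> edges G" and f: "f \<in> edges G" and disj: "e \<inter> f = {}"
    and not4: "\<nexists>a b c d. is_path4 a b c d \<or> is_cycle4 a b c d"
  shows "\<exists>c. edge_locating_coloring G (card (edges G) - 1) c"
proof -
  let ?m = "card (edges G)"
  have "e \<noteq> f" using disj e by (auto elim!: edge_obtain)
  have "card (edges G - {f}) = card {1..?m - 1}" using f finite_edges by simp
  then obtain h where h: "bij_betw h (edges G - {f}) {1..?m - 1}"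
    using finite_edges by (metis finite_Diff finite_atLeastAtMost finite_same_card_bij)
  \<comment> \<open>The bijection \<open>h\<close> numbers the edges other than \<open>f\<close>;
    then \<open>f\<close> copies the color of \<open>e\<close>.\<close>
  define c where "c = h(f := h e)"
  have cef: "c e = c f" using \<open>e \<noteq> f\<close> by (simp add: c_def)
  have img: "c ` edges G = {1..?m - 1}"
  proof -
    have "c f \<in> c ` (edges G - {f})" using cef e \<open>e \<noteq> f\<close> by (metis DiffI image_eqI singletonD)
    then have "c ` edges G = c ` (edges G - {f})" using f by (metis image_insert insert_Diff insert_absorb)
    also have "\<dots> = h ` (edges G - {f})" by (auto simp: c_def)
    finally show ?thesis using h by (simp add: bij_betw_def)
  qed
  have inj: "{g, g'} = {e, f}"
    if "g \<in> edges G" "g' \<in> edges G" "c g = c g'" "g \<noteq> g'" for g g'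
    using that h e \<open>e \<noteq> f\<close> by (auto simp: c_def bij_betw_def inj_on_def split: if_splits)
  have proper: "proper_edge_coloring G (?m - 1) c"
    unfolding proper_edge_coloring_def
    using img inj disj by (metis doubleton_eq_iff inf_commute)
  have "inj_on (edge_color_code G (?m - 1) c) (verts G)"
  proof (rule inj_onI)
    fix u v assume uv: "u \<in> verts G" "v \<in> verts G"
      and "edge_color_code G (?m - 1) c u = edge_color_code G (?m - 1) c v"
    then have code: "class_dist G u (color_class G c (c g)) = class_dist G v (color_class G c (c g))"
      if "g \<in> edges G" for g
      using that edge_color_code_eq_iff[OF img] by blast
    \<comment> \<open>The second part swaps the roles of \<open>u\<close> and \<open>v\<close>,
      which uses the equality of codes in reverse.\<close>
    have across: "\<not> (u \<in> e \<and> v \<in> f)" "\<not> (v \<in> e \<and> u \<in> f)"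
      using merged_coloring_conflict[OF e f disj cef inj] code code[symmetric] not4 by blast+
    have in_class: "u \<in> \<Union>(color_class G c (c g)) \<longleftrightarrow> v \<in> \<Union>(color_class G c (c g))"
      if "g \<in> edges G" for g
    proof -
      have "color_class G c (c g) \<subseteq> edges G" "color_class G c (c g) \<noteq> {}"
        using that by (auto simp: color_class_def)
      then show ?thesis using code[OF that] uv class_dist_eq_0_iff by metis
    qed
    \<comment> \<open>Here \<open>h\<close> is a bound edge that shadows the bijection chosen
      above.\<close>
    have "h = e \<or> h = f" if "h \<in> edges G" "c h = c e" for h
      using inj[of h e] that e by (metis doubleton_eq_iff)
    then have "color_class G c (c e) = {e, f}"
      using cef e f by (auto simp: color_class_def)
    then have ef: "u \<in> e \<union> f \<longleftrightarrow> v \<in> e \<union> f" using in_class[OF e] by simp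
    show "u = v"
    proof (rule same_edges_imp_eq[OF assms(1) uv])
      fix g assume g: "g \<in> edges G"
      show "u \<in> g \<longleftrightarrow> v \<in> g"
      proof (cases "g = e \<or> g = f")
        case True
        then show ?thesis using ef across disj by blast
      next
        case False
        then have "h = g" if "h \<in> edges G" "c h = c g" for h
          using inj[of h g] that g by (metis doubleton_eq_iff)
        then have "color_class G c (c g) = {g}"
          using g by (auto simp: color_class_def)
        then show ?thesis using in_class[OF g] by simp
      qed
    qed
  qed
  then show ?thesis using proper by (auto simp: edge_locating_coloring_def)
qed

section \<open>No repeated color on the path or cycle with four vertices\<close>

text \<open>The vertices \<open>u\<close> and \<open>v\<close> both have entry 0 for the repeated
  color and for the color of \<open>{u, v}\<close>. The inclusion \<open>sub\<close> lets one
  argument serve the path and the cycle, where \<open>{y, x}\<close> may be present.\<close>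

lemma repeated_color_conflict:
  assumes dist: "distinct [x, u, v, y]"
    and edges: "{x, u} \<in> edges G" "{u, v} \<in> edges G" "{v, y} \<in> edges G"
    and sub: "edges G \<subseteq> {{x, u}, {u, v}, {v, y}, {y, x}}"
    and c: "c {x, u} = c {v, y}"
  shows "\<not> edge_locating_coloring G k c"
proof
  assume loc: "edge_locating_coloring G k c"
  then have img: "c ` edges G = {1..k}"
    by (simp add: edge_locating_coloring_def proper_edge_coloring_def)
  have V: "u \<in> verts G" "v \<in> verts G" using edges edge_subset by auto
  have "class_dist G u (color_class G c (c g)) = class_dist G v (color_class G c (c g))"
    if g: "g \<in> edges G" for g
  proof -
    let ?C = "color_class G c (c g)"
    have C: "?C \<subseteq> edges G" "?C \<noteq> {}" using g by (auto simp: color_class_def)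
    show ?thesis
    proof (cases "c g = c {x, u} \<or> c g = c {u, v}")
      case True
      then have "u \<in> \<Union>?C" "v \<in> \<Union>?C"
        using edges c by (auto simp: color_class_def)
      then show ?thesis using class_dist_eq_0_iff C V by metis
    next
      case False
      \<comment> \<open>The only class left consists of \<open>{y, x}\<close>, adjacent to
        \<open>u\<close> through \<open>x\<close> and to \<open>v\<close> through
        \<open>y\<close>.\<close>
      then have "g = {y, x}" using g sub c by auto
      moreover have "?C = {{y, x}}"
        using False sub c g \<open>g = {y, x}\<close> by (auto simp: color_class_def)
      moreover have "{u, x} \<in> edges G" using edges(1) by (simp add: insert_commute)
      ultimately have "class_dist G u ?C = 1" "class_dist G v ?C = 1"
        using class_dist_eq_1_iff[OF _ C] V edges dist by auto
      then show ?thesis by simp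
    qed
  qed
  then have "edge_color_code G k c u = edge_color_code G k c v"
    using edge_color_code_eq_iff[OF img] by blast
  then show False
    using loc V dist by (auto simp: edge_locating_coloring_def inj_on_def)
qed

text \<open>By the pigeonhole principle two edges share a color, and properness forces them to be
  disjoint.\<close>

lemma fewer_colors_imp_disjoint_edges:
  assumes loc: "edge_locating_coloring G k c" and "k < card (edges G)"
  obtains e f where "e \<in> edges G" "f \<in> edges G" "e \<inter> f = {}" "c e = c f"
proof -
  have proper: "proper_edge_coloring G k c" using loc by (simp add: edge_locating_coloring_def)
  then have "card (c ` edges G) = k" by (simp add: proper_edge_coloring_def)
  then have "\<not> inj_on c (edges G)" using assms(2) card_image by fastforce
  then obtain e f where "e \<in> edges G" "f \<in> edges G" "e \<noteq> f" "c e = c f"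
    by (auto simp: inj_on_def)
  moreover from this have "e \<inter> f = {}" using proper by (meson proper_edge_coloring_def)
  ultimately show thesis using that by metis
qed

lemma path4_not_locating:
  assumes "is_path4 x u v y" "k < card (edges G)"
  shows "\<not> edge_locating_coloring G k c"
proof
  assume loc: "edge_locating_coloring G k c"
  then obtain e f where ef: "e \<in> edges G" "f \<in> edges G" "e \<inter> f = {}" "c e = c f"
    using fewer_colors_imp_disjoint_edges assms(2) by metis
  have E: "edges G = {{x, u}, {u, v}, {v, y}}" and d: "distinct [x, u, v, y]"
    using assms(1) by (auto simp: is_path4_def)
  \<comment> \<open>Going through all pairs of listed edges, those with a common vertex drop out and
    only the pair of end edges remains.\<close>
  have "\<forall>e\<in>edges G. \<forall>f\<in>edges G. e \<inter> f = {} \<longrightarrow> c e = c f \<longrightarrow> c {x, u} = c {v, y}"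
    unfolding E by simp
  then have "c {x, u} = c {v, y}" using ef by blast
  then show False using repeated_color_conflict[OF d] loc E by blast
qed

lemma cycle4_not_locating:
  assumes "is_cycle4 x u v y" "k < card (edges G)"
  shows "\<not> edge_locating_coloring G k c"
proof
  assume loc: "edge_locating_coloring G k c"
  then obtain e f where ef: "e \<in> edges G" "f \<in> edges G" "e \<inter> f = {}" "c e = c f"
    using fewer_colors_imp_disjoint_edges assms(2) by metis
  have E: "edges G = {{x, u}, {u, v}, {v, y}, {y, x}}" and d: "distinct [x, u, v, y]"
    using assms(1) by (auto simp: is_cycle4_def)
  \<comment> \<open>A cycle has two pairs of opposite edges; rotating the labels by one brings the
    second pair into the position of the first.\<close>
  have d': "distinct [u, v, y, x]" using d by auto
  have "\<forall>e\<in>edges G. \<forall>f\<in>edges G. e \<inter> f = {} \<longrightarrow> c e = c f \<longrightarrow>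
    c {x, u} = c {v, y} \<or> c {u, v} = c {y, x}"
    unfolding E by simp
  then have "c {x, u} = c {v, y} \<or> c {u, v} = c {y, x}" using ef by blast
  then show False
    using repeated_color_conflict[OF d, of c k] repeated_color_conflict[OF d', of c k] loc
    by (auto simp: E)
qed

section \<open>Structure of the graphs that need all colors\<close>

text \<open>A color can be saved only by repeating one on disjoint edges. Merging such a pair
  succeeds unless the graph is one of the two exceptions, where every repetition fails.\<close>

lemma edge_locating_number_eq_card_iff_structure:
  assumes "card (verts G) \<ge> 3" "edges G \<noteq> {}"
  shows "edge_locating_number G = card (edges G) \<longleftrightarrow>
    (\<exists>a b c d. is_path4 a b c d \<or> is_cycle4 a b c d) \<or>
    (\<forall>e\<in>edges G. \<forall>f\<in>edges G. e \<inter> f \<noteq> {})" (is "?L \<longleftrightarrow> ?four \<or> ?meet")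
proof
  assume L: ?L
  \<comment> \<open>Subtraction on \<open>nat\<close> truncates, so positivity is what makes
    \<open>card (edges G) - 1\<close> strictly smaller.\<close>
  have pos: "card (edges G) > 0" using assms(2) finite_edges by (simp add: card_gt_0_iff)
  have "\<not> edge_locating_coloring G (card (edges G) - 1) c" for c
    using L pos unfolding edge_locating_number_eq_card_iff[OF assms(1)]
    by (metis Suc_pred' lessI not_le)
  then show "?four \<or> ?meet"
    using disjoint_edges_imp_fewer_colors[OF assms(1)] by blast
next
  assume "?four \<or> ?meet"
  then have "card (edges G) \<le> k" if "edge_locating_coloring G k c" for k c
    using that path4_not_locating cycle4_not_locating fewer_colors_imp_disjoint_edges
    by (metis not_le)
  then show ?L unfolding edge_locating_number_eq_card_iff[OF assms(1)] by blast
qed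

text \<open>Take two edges \<open>{z, a}\<close> and \<open>{z, b}\<close>. An edge avoiding
  \<open>z\<close> must meet both, so it is \<open>{b, a}\<close>. Any edge meeting all three sides
  of this triangle contains two of its corners and is itself a side.\<close>

lemma pairwise_meeting_edges:
  assumes "card (edges G) \<ge> 2"
    and meet: "\<And>e f. e \<in> edges G \<Longrightarrow> f \<in> edges G \<Longrightarrow> e \<inter> f \<noteq> {}"
  shows "(\<exists>z\<in>verts G. \<forall>e\<in>edges G. z \<in> e) \<or>
    (\<exists>a b c. distinct [a, b, c] \<and> verts G = {a, b, c} \<and> edges G = {{a, b}, {b, c}, {c, a}})"
proof -
  obtain e f where ef: "e \<in> edges G" "f \<in> edges G" "e \<noteq> f"
    using assms(1) finite_edges by (metis card_le_Suc0_iff_eq not_less_eq_eq numeral_2_eq_2)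
  obtain z where "z \<in> e" "z \<in> f" using meet[OF ef(1,2)] by blast
  then obtain a b where a: "a \<noteq> z" "e = {z, a}" and b: "b \<noteq> z" "f = {z, b}"
    using edge_other_end ef by metis
  have dist: "distinct [a, z, b]" using a b ef by auto
  show ?thesis
  proof (cases "\<forall>g\<in>edges G. z \<in> g")
    case True
    then show ?thesis using \<open>z \<in> e\<close> ef(1) edge_subset by blast
  next
    case False
    then obtain g where g: "g \<in> edges G" "z \<notin> g" by blast
    obtain p q where pq: "g = {p, q}" using edge_obtain[OF g(1)] by metis
    have "g \<inter> {z, a} \<noteq> {}" "g \<inter> {z, b} \<noteq> {}" using meet ef g a b by blast+
    then have gab: "g = {b, a}" using g dist unfolding pq by auto
    have E: "edges G = {{a, z}, {z, b}, {b, a}}" (is "_ = ?T")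
    proof
      show "edges G \<subseteq> ?T"
      proof
        fix h assume h: "h \<in> edges G"
        obtain r s where rs: "h = {r, s}" "r \<noteq> s" using edge_obtain[OF h] by metis
        have "h \<inter> {z, a} \<noteq> {}" "h \<inter> {z, b} \<noteq> {}" "h \<inter> {b, a} \<noteq> {}"
          using meet h ef g a b gab by blast+
        then show "h \<in> ?T" using dist rs(2) unfolding rs(1) by auto
      qed
      show "?T \<subseteq> edges G" using ef a b g gab by (auto simp: insert_commute)
    qed
    have "{a, z, b} = verts G"
    proof (rule closed_eq_verts[of _ a])
      show "{a, z, b} \<subseteq> verts G" using ef a b edge_subset by blast
    qed (auto simp: E doubleton_eq_iff)
    then show ?thesis using E dist by blast
  qed
qed

section \<open>Isomorphism with the named graphs\<close>

text \<open>The map is reversed to go from \<open>H\<close> to \<open>G\<close>: for an explicit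
  \<open>H\<close>, the edge set of \<open>G\<close> then becomes an image that can be computed.
  Both graphs have only two-element edges, so preserving adjacency of pairs amounts to carrying one
  edge set onto the other.\<close>

lemma graph_iso_iff:
  assumes H: "finite_simple_graph H"
  shows "graph_iso G H \<longleftrightarrow>
    (\<exists>g. bij_betw g (verts H) (verts G) \<and> edges G = (`) g ` edges H)"
proof
  assume "graph_iso G H"
  then obtain f where f: "bij_betw f (verts G) (verts H)"
    and E: "\<And>x y. x \<in> verts G \<Longrightarrow> y \<in> verts G \<Longrightarrow> {x, y} \<in> edges G \<longleftrightarrow> {f x, f y} \<in> edges H"
    by (auto simp: graph_iso_def)
  define g where "g = inv_into (verts G) f"
  have g: "bij_betw g (verts H) (verts G)"
    unfolding g_def by (rule bij_betw_inv_into[OF f])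
  have gf: "g (f x) = x" if "x \<in> verts G" for x
    using that f unfolding g_def by (rule bij_betw_inv_into_left[rotated])
  have fg: "f (g x) = x" if "x \<in> verts H" for x
    using that f unfolding g_def by (rule bij_betw_inv_into_right[rotated])
  have gV: "g x \<in> verts G" if "x \<in> verts H" for x
    using that g by (auto simp: bij_betw_def)
  have "edges G = (`) g ` edges H"
  proof (intro subset_antisym subsetI)
    fix e assume e: "e \<in> edges G"
    then obtain x y where xy: "e = {x, y}" using edge_obtain by metis
    then have V: "x \<in> verts G" "y \<in> verts G" using e edge_subset by auto
    then have "{f x, f y} \<in> edges H" using E e xy by blast
    moreover have "e = g ` {f x, f y}" using gf V xy by auto
    ultimately show "e \<in> (`) g ` edges H" by blast
  next
    fix e assume "e \<in> (`) g ` edges H"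
    then obtain e' where e': "e' \<in> edges H" "e = g ` e'" by blast
    then have "card e' = 2" "e' \<subseteq> verts H" using H by (auto simp: finite_simple_graph_def)
    then obtain x y where xy: "e' = {x, y}" "x \<in> verts H" "y \<in> verts H"
      by (auto simp: card_2_iff)
    then show "e \<in> edges G" using e' E[of "g x" "g y"] gV fg by auto
  qed
  then show "\<exists>g. bij_betw g (verts H) (verts G) \<and> edges G = (`) g ` edges H" using g by blast
next
  assume "\<exists>g. bij_betw g (verts H) (verts G) \<and> edges G = (`) g ` edges H"
  then obtain g where g: "bij_betw g (verts H) (verts G)" and E: "edges G = (`) g ` edges H"
    by blast
  define f where "f = inv_into (verts H) g"
  have f: "bij_betw f (verts G) (verts H)"
    unfolding f_def by (rule bij_betw_inv_into[OF g])
  have gf: "g (f x) = x" if "x \<in> verts G" for x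
    using that g unfolding f_def by (rule bij_betw_inv_into_right[rotated])
  have fV: "f x \<in> verts H" if "x \<in> verts G" for x
    using that f by (auto simp: bij_betw_def)
  have "{x, y} \<in> edges G \<longleftrightarrow> {f x, f y} \<in> edges H" if V: "x \<in> verts G" "y \<in> verts G" for x y
  proof
    assume "{x, y} \<in> edges G"
    \<comment> \<open>The edge \<open>e\<close> is known only through its image; injectivity of
      \<open>g\<close> on the vertices of \<open>H\<close> recovers it.\<close>
    then obtain e where e: "e \<in> edges H" "g ` e = g ` {f x, f y}"
      unfolding E using gf V by auto
    moreover have "e \<subseteq> verts H" using H e by (auto simp: finite_simple_graph_def)
    moreover have "{f x, f y} \<subseteq> verts H" using fV V by auto
    ultimately have "e = {f x, f y}"
      using g inj_on_image_eq_iff unfolding bij_betw_def by metis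
    then show "{f x, f y} \<in> edges H" using e by simp
  next
    assume "{f x, f y} \<in> edges H"
    then have "g ` {f x, f y} \<in> edges G" unfolding E by blast
    then show "{x, y} \<in> edges G" using gf V by simp
  qed
  then show "graph_iso G H" unfolding graph_iso_def using f by blast
qed

text \<open>A bijection from \<open>{..<n}\<close> is a list of distinct vertices. For a fixed small
  \<open>n\<close>, the quantifier over maps becomes one over \<open>n\<close> named
  vertices.\<close>

lemma graph_iso_iff_list:
  assumes H: "finite_simple_graph H" "verts H = {..<n}"
  shows "graph_iso G H \<longleftrightarrow>
    (\<exists>xs. length xs = n \<and> distinct xs \<and> set xs = verts G \<and> edges G = (`) ((!) xs) ` edges H)"
  unfolding graph_iso_iff[OF H(1)]
proof
  assume "\<exists>g. bij_betw g (verts H) (verts G) \<and> edges G = (`) g ` edges H"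
  then obtain g where g: "bij_betw g {..<n} (verts G)" and E: "edges G = (`) g ` edges H"
    using H by auto
  \<comment> \<open>List lookup agrees with \<open>g\<close> only below \<open>n\<close>, which
    covers every vertex on an edge of \<open>H\<close>.\<close>
  have "(!) (map g [0..<n]) ` e = g ` e" if "e \<in> edges H" for e
  proof (rule image_cong)
    fix i assume "i \<in> e"
    then have "i < n" using that H by (auto simp: finite_simple_graph_def)
    then show "map g [0..<n] ! i = g i" by simp
  qed simp
  then have "edges G = (`) ((!) (map g [0..<n])) ` edges H" unfolding E by auto
  moreover have "set (map g [0..<n]) = verts G" "distinct (map g [0..<n])"
    using g by (auto simp: bij_betw_def distinct_map atLeast0LessThan)
  ultimately show "\<exists>xs. length xs = n \<and> distinct xs \<and> set xs = verts G \<and>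
      edges G = (`) ((!) xs) ` edges H"
    by (intro exI[of _ "map g [0..<n]"]) simp
next
  assume "\<exists>xs. length xs = n \<and> distinct xs \<and> set xs = verts G \<and> edges G = (`) ((!) xs) ` edges H"
  then show "\<exists>g. bij_betw g (verts H) (verts G) \<and> edges G = (`) g ` edges H"
    using H(2) bij_betw_nth by metis
qed

lemma graph_iso_path4_iff: "graph_iso G (path_graph 4) \<longleftrightarrow> (\<exists>x u v y. is_path4 x u v y)"
proof -
  have V: "verts (path_graph 4) = {..<4}" by (simp add: path_graph_def)
  have "finite_simple_graph (path_graph 4)"
    unfolding finite_simple_graph_def edges_path4 V by auto
  note iff = graph_iso_iff_list[OF this V]
  show ?thesis
  proof
    assume "graph_iso G (path_graph 4)"
    then obtain xs where xs: "length xs = 4" "distinct xs" "set xs = verts G"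
      and E: "edges G = (`) ((!) xs) ` edges (path_graph 4)" unfolding iff by blast
    from xs(1) obtain x u v y where "xs = [x, u, v, y]"
      by (auto simp: numeral_eq_Suc length_Suc_conv)
    then have "is_path4 x u v y"
      using xs E unfolding is_path4_def edges_path4 by simp
    then show "\<exists>x u v y. is_path4 x u v y" by blast
  next
    assume "\<exists>x u v y. is_path4 x u v y"
    then obtain x u v y where "is_path4 x u v y" by blast
    then show "graph_iso G (path_graph 4)"
      unfolding iff edges_path4 is_path4_def by (intro exI[of _ "[x, u, v, y]"]) simp
  qed
qed

lemma graph_iso_cycle4_iff: "graph_iso G (cycle_graph 4) \<longleftrightarrow> (\<exists>x u v y. is_cycle4 x u v y)"
proof -
  have V: "verts (cycle_graph 4) = {..<4}" by (simp add: cycle_graph_def)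
  have "finite_simple_graph (cycle_graph 4)"
    unfolding finite_simple_graph_def edges_cycle4 V by auto
  note iff = graph_iso_iff_list[OF this V]
  show ?thesis
  proof
    assume "graph_iso G (cycle_graph 4)"
    then obtain xs where xs: "length xs = 4" "distinct xs" "set xs = verts G"
      and E: "edges G = (`) ((!) xs) ` edges (cycle_graph 4)" unfolding iff by blast
    from xs(1) obtain x u v y where "xs = [x, u, v, y]"
      by (auto simp: numeral_eq_Suc length_Suc_conv)
    then have "is_cycle4 x u v y"
      using xs E unfolding is_cycle4_def edges_cycle4 by simp
    then show "\<exists>x u v y. is_cycle4 x u v y" by blast
  next
    assume "\<exists>x u v y. is_cycle4 x u v y"
    then obtain x u v y where "is_cycle4 x u v y" by blast
    then show "graph_iso G (cycle_graph 4)"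
      unfolding iff edges_cycle4 is_cycle4_def by (intro exI[of _ "[x, u, v, y]"]) simp
  qed
qed

lemma graph_iso_cycle3_iff: "graph_iso G (cycle_graph 3) \<longleftrightarrow>
  (\<exists>a b c. distinct [a, b, c] \<and> verts G = {a, b, c} \<and> edges G = {{a, b}, {b, c}, {c, a}})"
  (is "_ \<longleftrightarrow> (\<exists>a b c. ?T a b c)")
proof -
  have V: "verts (cycle_graph 3) = {..<3}" by (simp add: cycle_graph_def)
  have "finite_simple_graph (cycle_graph 3)"
    unfolding finite_simple_graph_def edges_cycle3 V by auto
  note iff = graph_iso_iff_list[OF this V]
  show ?thesis
  proof
    assume "graph_iso G (cycle_graph 3)"
    then obtain xs where xs: "length xs = 3" "distinct xs" "set xs = verts G"
      and E: "edges G = (`) ((!) xs) ` edges (cycle_graph 3)" unfolding iff by blast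
    from xs(1) obtain a b c where "xs = [a, b, c]"
      by (auto simp: numeral_eq_Suc length_Suc_conv)
    then have "?T a b c" using xs E unfolding edges_cycle3 by simp
    then show "\<exists>a b c. ?T a b c" by blast
  next
    assume "\<exists>a b c. ?T a b c"
    then obtain a b c where "?T a b c" by blast
    then show "graph_iso G (cycle_graph 3)"
      unfolding iff edges_cycle3 by (intro exI[of _ "[a, b, c]"]) simp
  qed
qed

text \<open>If every edge contains \<open>z\<close>, connectedness makes all other vertices
  neighbours of \<open>z\<close>. They correspond one to one with the edges, so there are as many of
  them as leaves of the star.\<close>

lemma graph_iso_star_iff:
  "graph_iso G (star_graph (card (edges G))) \<longleftrightarrow> (\<exists>z\<in>verts G. \<forall>e\<in>edges G. z \<in> e)"
proof -
  let ?m = "card (edges G)"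
  have V: "verts (star_graph ?m) = {0..?m}"
    and E: "edges (star_graph ?m) = (\<lambda>i. {0, i}) ` {1..?m}"
    by (auto simp: star_graph_def)
  have "finite_simple_graph (star_graph ?m)"
    unfolding finite_simple_graph_def E V by auto
  note iff = graph_iso_iff[OF this]
  show ?thesis
  proof
    assume "graph_iso G (star_graph ?m)"
    then obtain g where g: "bij_betw g {0..?m} (verts G)"
      and Eg: "edges G = (`) g ` (\<lambda>i. {0, i}) ` {1..?m}" unfolding iff E V by blast
    have "g 0 \<in> verts G" using g by (auto simp: bij_betw_def)
    then show "\<exists>z\<in>verts G. \<forall>e\<in>edges G. z \<in> e" using Eg by auto
  next
    assume "\<exists>z\<in>verts G. \<forall>e\<in>edges G. z \<in> e"
    then obtain z where z: "z \<in> verts G" and ze: "\<And>e. e \<in> edges G \<Longrightarrow> z \<in> e" by blast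
    have "insert z {w. {z, w} \<in> edges G} = verts G"
    proof (rule closed_eq_verts[of _ z])
      show "insert z {w. {z, w} \<in> edges G} \<subseteq> verts G" using z edge_subset by blast
    next
      fix x y assume "x \<in> insert z {w. {z, w} \<in> edges G}" "{x, y} \<in> edges G"
      then show "y \<in> insert z {w. {z, w} \<in> edges G}" using ze[of "{x, y}"] by auto
    qed simp
    then have nb: "{z, w} \<in> edges G" if "w \<in> verts G - {z}" for w using that by blast
    have EG: "edges G = (\<lambda>w. {z, w}) ` (verts G - {z})"
    proof
      show "edges G \<subseteq> (\<lambda>w. {z, w}) ` (verts G - {z})"
      proof
        fix e assume e: "e \<in> edges G"
        then obtain w where "w \<noteq> z" "e = {z, w}" using edge_other_end ze by metis
        then show "e \<in> (\<lambda>w. {z, w}) ` (verts G - {z})" using e edge_subset by blast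
      qed
    qed (use nb in auto)
    have "inj_on (\<lambda>w. {z, w}) (verts G - {z})" by (auto simp: inj_on_def doubleton_eq_iff)
    then have "?m = card (verts G - {z})" by (subst EG) (rule card_image)
    then have "card {1..?m} = card (verts G - {z})" by simp
    then obtain h where h: "bij_betw h {1..?m} (verts G - {z})"
      using finite_verts by (metis finite_Diff finite_atLeastAtMost finite_same_card_bij)
    \<comment> \<open>The center 0 goes to \<open>z\<close>; the leaves start at 1, so
      \<open>h\<close> is unchanged on them.\<close>
    define g where "g = h(0 := z)"
    have "bij_betw g {1..?m} (verts G - {z})"
      using h by (rule bij_betw_cong[THEN iffD1, rotated]) (simp add: g_def)
    then have "bij_betw g ({1..?m} \<union> {0}) ((verts G - {z}) \<union> {z})"
      using notIn_Un_bij_betw[of 0 "{1..?m}" g "verts G - {z}"] by (simp add: g_def)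
    moreover have "{1..?m} \<union> {0} = {0..?m}" "(verts G - {z}) \<union> {z} = verts G"
      using z by auto
    ultimately have "bij_betw g {0..?m} (verts G)" by simp
    moreover have "edges G = (`) g ` (\<lambda>i. {0, i}) ` {1..?m}"
    proof -
      have "edges G = (\<lambda>w. {z, w}) ` h ` {1..?m}" using EG h by (simp add: bij_betw_def)
      also have "\<dots> = (`) g ` (\<lambda>i. {0, i}) ` {1..?m}"
        unfolding image_image by (rule image_cong) (auto simp: g_def)
      finally show ?thesis .
    qed
    ultimately show "graph_iso G (star_graph ?m)" unfolding iff E V by blast
  qed
qed

lemma pairwise_meeting_iff_iso:
  assumes "card (edges G) \<ge> 2"
  shows "(\<forall>e\<in>edges G. \<forall>f\<in>edges G. e \<inter> f \<noteq> {}) \<longleftrightarrow>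
    graph_iso G (cycle_graph 3) \<or> graph_iso G (star_graph (card (edges G)))"
  unfolding graph_iso_cycle3_iff graph_iso_star_iff
proof
  assume "\<forall>e\<in>edges G. \<forall>f\<in>edges G. e \<inter> f \<noteq> {}"
  then show "(\<exists>a b c. distinct [a, b, c] \<and> verts G = {a, b, c} \<and> edges G = {{a, b}, {b, c}, {c, a}})
      \<or> (\<exists>z\<in>verts G. \<forall>e\<in>edges G. z \<in> e)"
    using pairwise_meeting_edges[OF assms] by blast
next
  assume "(\<exists>a b c. distinct [a, b, c] \<and> verts G = {a, b, c} \<and> edges G = {{a, b}, {b, c}, {c, a}})
      \<or> (\<exists>z\<in>verts G. \<forall>e\<in>edges G. z \<in> e)"
  then show "\<forall>e\<in>edges G. \<forall>f\<in>edges G. e \<inter> f \<noteq> {}"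
  proof (elim disjE exE conjE)
    fix a b c assume "edges G = {{a, b}, {b, c}, {c, a}}"
    then show ?thesis by simp
  qed blast
qed

end

theorem theorem5:
  fixes G :: "'a graph" and m :: nat
  assumes "finite_simple_graph G"
    and "connected_graph G"
    and "card (verts G) \<ge> 3"
    and "card (edges G) = m"
    and "m \<ge> 2"
  shows "edge_locating_number G = m \<longleftrightarrow>
    graph_iso G (path_graph 4) \<or> graph_iso G (cycle_graph 3) \<or>
    graph_iso G (cycle_graph 4) \<or> graph_iso G (star_graph m)"
proof -
  interpret finite_connected_graph G
    using assms by unfold_locales
  have "edges G \<noteq> {}" "card (edges G) \<ge> 2" using assms by auto
  then show ?thesis
    using edge_locating_number_eq_card_iff_structure[OF assms(3)]
      pairwise_meeting_iff_iso graph_iso_path4_iff graph_iso_cycle4_iff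
    unfolding assms(4) by blast
qed

end
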